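(* Let $a<0$ and $b\in\mathbb{R}$, and let $F=F_{a,b}:\mathbb{R}^2\to\mathbb{R}^2$, $F(x,y)=(|x|-y+a,\;x-|y|+b)$. Then there is a compact graph $\Gamma=\Gamma_{a,b}\subset\mathbb{R}^2$, invariant under $F$ (i.e. $F(\Gamma)\subset\Gamma$), such that for every $\mathbf{x}\in\mathbb{R}^2$ there exists a non-negative integer $n$ (that may depend on $\mathbf{x}$) such that $F^n(\mathbf{x})\in\Gamma$.
   Context: A graph is a pair $(X,V)$ where $X$ is a compact Hausdorff space and $V\subset X$ is a finite set such that $X\setminus V$ is the disjoint union of a finite number of open subsets of $X$ (edges), each homeomorphic to an open interval of the real line. Isolated points are allowed, as is a graph reduced to a single point. Here the graph is a subset of $\mathbb{R}^2$ with the induced topology. *)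

theory Defs
  imports "HOL-Analysis.Analysis"
begin

text \<open>
  The vertex set is part of the data, as in the pair (X, V); the edges are an existentially
  quantified finite partition of the complement of the vertex set.
\<close>

definition graph :: "'a topology \<Rightarrow> 'a set \<Rightarrow> bool" where
  "graph X V \<longleftrightarrow>
     compact_space X \<and> Hausdorff_space X \<and> finite V \<and> V \<subseteq> topspace X \<and>
     (\<exists>\<E>. finite \<E> \<and> disjoint \<E> \<and> \<Union>\<E> = topspace X - V \<and>
        (\<forall>e\<in>\<E>. openin X e \<and>
           (\<exists>I :: real set. open I \<and> is_interval I \<and> I \<noteq> {} \<and>
              subtopology X e homeomorphic_space top_of_set I)))"

definition F :: "real \<Rightarrow> real \<Rightarrow> real \<times> real \<Rightarrow> real \<times> real" where
  "F a b = (\<lambda>(x, y). (\<bar>x\<bar> - y + a, x - \<bar>y\<bar> + b))"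

end

theory Submission
  imports Defs
begin

text \<open>
  On each closed quadrant the map is affine. On the first and third quadrant it has rank one: the
  first is mapped to the line through \<open>(a, b)\<close> of slope 1, the third to the line through \<open>(a, b)\<close>
  of slope -1. On the second and fourth quadrant it is a similarity with ratio \<open>sqrt 2\<close> which
  rotates by a multiple of 45 degrees. All orbits enter a compact convex polygon \<open>trap\<close> that is
  invariant under the map (\<open>F_power5_trap\<close>, \<open>F_trap\<close>), because the homogeneous map with
  \<open>a = b = 0\<close> is nilpotent. Let \<open>K\<close> be the part of the two lines inside \<open>trap\<close>. An orbit meets \<open>K\<close>
  as soon as it has visited the first or the third quadrant, and one would like to take for the
  graph the union of all forward images of \<open>K\<close>. These images are made of segments, and the issue is
  that finitely many segments suffice.

  More generally, each segment in \<open>trap\<close> lies in a finite union of segments that is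
  invariant up to points of \<open>K\<close>. This is proved backwards along the dynamics, region by region.
  Segments in the collapsing quadrants are mapped into \<open>K\<close>. For \<open>a < 0\<close> the only ways to avoid
  these quadrants for ever are to end up staying in the second quadrant, or staying in the fourth
  quadrant, or following the periodic itinerary fourth, second, second quadrant. Along each of
  these three loops some power of the return map is an expanding homothety. It maps lines through
  its centre into themselves and drives all other lines out of the polygon, so a segment
  produces only finitely many lines before it leaves the loop
  (\<open>tame_region_loop\<close>). The same expansion shows that the only points which stay in a loop for ever
  are the centres, and finitely many points suffice to catch the orbits that never meet \<open>K\<close>.
  Applied to the segments that make up \<open>K\<close> and to these points, this yields a finite union of
  segments which is invariant and absorbs every orbit; and a finite union of segments is a graph
  (\<open>graph_Union_segments\<close>).
\<close>

section \<open>Segments and lines\<close>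

definition line :: "'a::real_vector \<Rightarrow> 'a \<Rightarrow> 'a set" where
  "line base d = range (\<lambda>t. base + t *\<^sub>R d)"

lemma affine_line: "affine (line base d)"
proof -
  have "u *\<^sub>R (base + s *\<^sub>R d) + v *\<^sub>R (base + t *\<^sub>R d) = base + (u * s + v * t) *\<^sub>R d"
    if "u + v = 1" for u v s t
  proof -
    have v: "v = 1 - u" using that by simp
    show ?thesis unfolding v by (simp add: algebra_simps)
  qed
  then show ?thesis unfolding affine_def line_def by blast
qed

lemma closed_line: "closed (line base (d :: 'a::euclidean_space))"
  by (rule affine_closed) (rule affine_line)

lemma convex_line: "convex (line base d)"
  by (rule affine_imp_convex) (rule affine_line)

lemma collinear_obtain_line:
  fixes S :: "'a::euclidean_space set"
  assumes "collinear S"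
  obtains base d where "d \<noteq> 0" "S \<subseteq> line base d"
proof -
  obtain d where d: "d \<noteq> 0" "\<And>x y. x \<in> S \<Longrightarrow> y \<in> S \<Longrightarrow> \<exists>c. x - y = c *\<^sub>R d"
    using assms unfolding collinear by blast
  show thesis
  proof (cases "S = {}")
    case False
    then obtain base where base: "base \<in> S" by blast
    have "x \<in> line base d" if x: "x \<in> S" for x
    proof -
      obtain c where "x - base = c *\<^sub>R d" using d(2)[OF x base] by blast
      then have "x = base + c *\<^sub>R d" by (simp add: algebra_simps)
      then show ?thesis unfolding line_def by (rule range_eqI)
    qed
    then show thesis by (intro that[OF d(1)] subsetI)
  next
    case True
    then show thesis by (intro that[OF d(1)]) simp
  qed
qed

lemma closed_segment_on_line:
  fixes base d :: "'a::real_vector"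
  shows "closed_segment (base + s *\<^sub>R d) (base + t *\<^sub>R d) =
    (\<lambda>r. base + r *\<^sub>R d) ` closed_segment s t"
proof -
  have "linear (\<lambda>r::real. r *\<^sub>R d)" by (simp add: linearI scaleR_left_distrib)
  note lin = closed_segment_linear_image[OF this, of s t]
  show ?thesis unfolding closed_segment_translation lin image_image ..
qed

lemma open_segment_on_line:
  fixes base d :: "'a::real_vector"
  assumes "d \<noteq> 0"
  shows "open_segment (base + s *\<^sub>R d) (base + t *\<^sub>R d) =
    (\<lambda>r. base + r *\<^sub>R d) ` open_segment s t"
  using assms by (auto simp: open_segment_def closed_segment_on_line)

lemma open_segment_homeomorphic_interval:
  fixes u v :: "'a::euclidean_space"
  assumes "u \<noteq> v"
  shows "\<exists>I :: real set. open I \<and> is_interval I \<and> I \<noteq> {} \<and>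
           top_of_set (open_segment u v) homeomorphic_space top_of_set I"
proof -
  define d where "d = v - u"
  define f where "f = (\<lambda>r. u + r *\<^sub>R d)"
  define g where "g = (\<lambda>x. (x - u) \<bullet> d / (d \<bullet> d))"
  have d: "d \<noteq> 0" using assms by (simp add: d_def)
  then have gf: "g (f r) = r" for r by (simp add: f_def g_def)
  have e: "open_segment u v = f ` {0<..<1}"
    using open_segment_on_line[OF d, of u 0 1]
    by (simp add: f_def open_segment_eq_real_ivl d_def)
  have cont: "continuous_on A f" "continuous_on B g" for A B
    unfolding f_def g_def using d by (intro continuous_intros; simp)+
  have "homeomorphic_maps (top_of_set (f ` {0<..<1})) (top_of_set {0<..<1}) g f"
    unfolding homeomorphic_maps_def using cont by (auto simp: gf)
  then show ?thesis
    unfolding homeomorphic_space_def e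
    by (intro exI[of _ "{0<..<1::real}"] conjI exI) (simp_all add: is_interval_oo)
qed

text \<open>
  If the interior of a segment misses both ends of another segment on the same line, then by
  connectedness it cannot leave that segment once it has met it. This is what makes two edges
  coincide as soon as they share a point.
\<close>

lemma real_open_segment_trapped:
  fixes x u v p r :: real
  assumes "x \<in> open_segment u v" "x \<in> closed_segment p r" "p \<notin> open_segment u v" "r \<notin> open_segment u v"
  shows "open_segment u v \<subseteq> open_segment p r" "u \<in> closed_segment p r" "v \<in> closed_segment p r"
proof -
  have *: "min p r \<le> min u v" "max u v \<le> max p r" "u \<noteq> v"
    using assms by (auto simp: open_segment_eq_real_ivl closed_segment_eq_real_ivl min_def max_def split: if_splits)
  show "u \<in> closed_segment p r" "v \<in> closed_segment p r"
   using * by (auto simp: closed_segment_eq_real_ivl min_def max_def split: if_splits)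
  show "open_segment u v \<subseteq> open_segment p r"
   using * by (auto simp: open_segment_eq_real_ivl min_def max_def split: if_splits)
qed

lemma open_segment_trapped:
  fixes S :: "'a::euclidean_space set"
  assumes S: "collinear S" "u \<in> S" "v \<in> S" "p \<in> S" "r \<in> S"
    and x: "x \<in> open_segment u v" "x \<in> closed_segment p r"
    and pr: "p \<notin> open_segment u v" "r \<notin> open_segment u v"
  shows "open_segment u v \<subseteq> open_segment p r \<and> u \<in> closed_segment p r \<and> v \<in> closed_segment p r"
proof -
  obtain base d where d: "d \<noteq> 0" and "S \<subseteq> line base d"
    using collinear_obtain_line[OF S(1)] by blast
  define f where "f = (\<lambda>t. base + t *\<^sub>R d)"
  have range: "S \<subseteq> range f" using \<open>S \<subseteq> line base d\<close> by (simp add: line_def f_def)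
  have inj: "f s = f t \<longleftrightarrow> s = t" for s t using d by (auto simp: f_def)
  obtain u' where u': "u = f u'" using subsetD[OF range S(2)] by blast
  obtain v' where v': "v = f v'" using subsetD[OF range S(3)] by blast
  obtain p' where p': "p = f p'" using subsetD[OF range S(4)] by blast
  obtain r' where r': "r = f r'" using subsetD[OF range S(5)] by blast
  note e = u' v' p' r'
  have os: "open_segment (f s) (f t) = f ` open_segment s t" for s t
    using open_segment_on_line[OF d] by (simp add: f_def)
  have cs: "closed_segment (f s) (f t) = f ` closed_segment s t" for s t
    by (simp add: f_def closed_segment_on_line)
  obtain x' where x': "x = f x'" "x' \<in> open_segment u' v'"
    using x(1) unfolding e os by blast
  have x'': "x' \<in> closed_segment p' r'"
    using x(2) unfolding e cs x' by (auto simp: inj)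
  have "p' \<notin> open_segment u' v'" "r' \<notin> open_segment u' v'"
    using pr unfolding e os by auto
  then have "open_segment u' v' \<subseteq> open_segment p' r' \<and> u' \<in> closed_segment p' r' \<and> v' \<in> closed_segment p' r'"
    using real_open_segment_trapped[OF x'(2) x''] by blast
  then show ?thesis unfolding e os cs by (intro conjI image_mono imageI) simp_all
qed

lemma open_segments_eq:
  fixes S :: "'a::euclidean_space set"
  assumes S: "collinear S" "u \<in> S" "v \<in> S" "p \<in> S" "r \<in> S"
    and x: "x \<in> open_segment u v" "x \<in> open_segment p r"
    and pr: "p \<notin> open_segment u v" "r \<notin> open_segment u v"
    and uv: "u \<notin> open_segment p r" "v \<notin> open_segment p r"
  shows "open_segment u v = open_segment p r"
proof (rule subset_antisym)
  have cl: "x \<in> closed_segment u v" "x \<in> closed_segment p r"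
    using x by (simp_all add: open_segment_def)
  show "open_segment u v \<subseteq> open_segment p r"
    using open_segment_trapped[OF S x(1) cl(2) pr] by (rule conjunct1)
  show "open_segment p r \<subseteq> open_segment u v"
    using open_segment_trapped[OF S(1,4,5,2,3) x(2) cl(1) uv] by (rule conjunct1)
qed

lemma gap_around_point:
  fixes u v x :: "'a::euclidean_space"
  assumes V: "finite V" "u \<in> V" "v \<in> V" and x: "x \<in> closed_segment u v" "x \<notin> V"
  obtains u' v' where "u' \<in> V" "v' \<in> V" "u' \<in> closed_segment u v" "v' \<in> closed_segment u v"
    "x \<in> open_segment u' v'" "open_segment u' v' \<inter> V = {}"
proof -
  have uv: "u \<noteq> v" using x V by auto
  define d where "d = v - u"
  define f where "f = (\<lambda>t. u + t *\<^sub>R d)"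
  have d: "d \<noteq> 0" using uv by (simp add: d_def)
  have inj: "f s = f t \<longleftrightarrow> s = t" for s t using d by (auto simp: f_def)
  have os: "open_segment (f s) (f t) = f ` open_segment s t" for s t
    using open_segment_on_line[OF d] by (simp add: f_def)
  have f01: "f 0 = u" "f 1 = v" by (auto simp: f_def d_def)
  have cs: "closed_segment u v = f ` {0..1}"
    using closed_segment_on_line[of u 0 d 1] by (simp add: f_def d_def closed_segment_eq_real_ivl)
  obtain t where t: "x = f t" "0 \<le> t" "t \<le> 1" using x(1) unfolding cs by auto
  define D where "D = {s. 0 \<le> s \<and> s \<le> 1 \<and> f s \<in> V}"
  have "inj_on f D" by (auto simp: inj_on_def inj)
  moreover have "finite (f ` D)" by (rule finite_subset[OF _ V(1)]) (auto simp: D_def)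
  ultimately have fin: "finite D" using finite_imageD by blast
  have D01: "0 \<in> D" "1 \<in> D" using V by (auto simp: D_def f01)
  have tD: "t \<notin> D" using x(2) t by (auto simp: D_def)
  have t01: "0 < t" "t < 1" using tD D01 t(2,3) by (metis order_le_less)+
  \<comment> \<open>The neighbours of \<open>x\<close> in \<open>V\<close>, in the parametrisation of the segment by \<open>[0, 1]\<close>.\<close>
  define l where "l = Max {s\<in>D. s < t}"
  define m where "m = Min {s\<in>D. t < s}"
  have "l \<in> {s\<in>D. s < t}" unfolding l_def using fin D01 t01 by (intro Max_in) auto
  then have l: "l \<in> D" "l < t" by auto
  have "m \<in> {s\<in>D. t < s}" unfolding m_def using fin D01 t01 by (intro Min_in) auto
  then have m: "m \<in> D" "t < m" by auto
  have lmax: "s \<le> l" if "s \<in> D" "s < t" for s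
    unfolding l_def using that fin by (intro Max_ge) auto
  have mmin: "m \<le> s" if "s \<in> D" "t < s" for s
    unfolding m_def using that fin by (intro Min_le) auto
  have seg: "open_segment (f l) (f m) = f ` {l<..<m}"
    using os l m by (simp add: open_segment_eq_real_ivl)
  show thesis
  proof
    show "f l \<in> V" "f m \<in> V" "f l \<in> closed_segment u v" "f m \<in> closed_segment u v"
      using l m unfolding cs D_def by auto
    show "x \<in> open_segment (f l) (f m)" unfolding seg using t l m by auto
    show "open_segment (f l) (f m) \<inter> V = {}"
    proof (rule ccontr)
      assume "open_segment (f l) (f m) \<inter> V \<noteq> {}"
      then obtain s where s: "l < s" "s < m" "f s \<in> V" unfolding seg by fastforce
      then have sD: "s \<in> D" using l m by (auto simp: D_def)
      consider "s < t" | "s = t" | "t < s" by linarith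
      then show False
        using lmax[OF sD] mmin[OF sD] s(1,2) sD tD by cases auto
    qed
  qed
qed

text \<open>
  Segments are taken in this form, which includes points and the empty set, because it is visibly
  stable under intersection with compact convex sets.
\<close>

definition seg :: "'a::euclidean_space set \<Rightarrow> bool" where
  "seg S \<longleftrightarrow> compact S \<and> convex S \<and> collinear S"

lemma seg_Int: "seg S \<Longrightarrow> compact C \<Longrightarrow> convex C \<Longrightarrow> seg (S \<inter> C)"
  unfolding seg_def by (auto intro: collinear_subset compact_Int convex_Int)

section \<open>Finite unions of segments are graphs\<close>

text \<open>
  The vertices are the ends of all pairwise intersections \<open>S \<inter> T\<close>; with \<open>T = S\<close> these include the
  ends of the segments themselves. Overlapping segments are harmless: \<open>S \<inter> T\<close> is again a segment
  with ends among the vertices. The edges are the open segments between consecutive vertices on one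
  of the given segments. Two edges that share a point \<open>x\<close>, one on \<open>S\<close> and one on \<open>T\<close>, both lie in
  \<open>S \<inter> T\<close>, because they contain no vertex, and hence coincide.
\<close>

lemma graph_Union_segments:
  fixes \<S> :: "'a::euclidean_space set set"
  assumes fin: "finite \<S>" and seg: "\<And>S. S \<in> \<S> \<Longrightarrow> seg S"
  shows "\<exists>V. graph (top_of_set (\<Union>\<S>)) V"
proof -
  have "\<exists>e. S \<inter> T \<noteq> {} \<longrightarrow> S \<inter> T = closed_segment (fst e) (snd e)" if "S \<in> \<S>" "T \<in> \<S>" for S T
  proof (cases "S \<inter> T = {}")
    case False
    moreover have "compact (S \<inter> T)" "convex (S \<inter> T)" "collinear (S \<inter> T)"
      using seg[OF that(1)] seg[OF that(2)]
      by (auto simp: seg_def compact_Int convex_Int intro: collinear_subset)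
    ultimately obtain p r where "S \<inter> T = closed_segment p r"
      using compact_convex_collinear_segment by metis
    then show ?thesis by (intro exI[of _ "(p, r)"]) auto
  qed auto
  then obtain e where e: "\<And>S T. S \<in> \<S> \<Longrightarrow> T \<in> \<S> \<Longrightarrow> S \<inter> T \<noteq> {} \<Longrightarrow>
      S \<inter> T = closed_segment (fst (e S T)) (snd (e S T))" by metis
  define V where "V = (\<Union>S\<in>\<S>. \<Union>T\<in>\<S>. if S \<inter> T = {} then {} else {fst (e S T), snd (e S T)})"
  have finV: "finite V" unfolding V_def using fin by auto
  have endsV: "fst (e S T) \<in> V \<and> snd (e S T) \<in> V"
    if "S \<in> \<S>" "T \<in> \<S>" "S \<inter> T \<noteq> {}" for S T
  proof -
    have "{fst (e S T), snd (e S T)} \<subseteq> V"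
      unfolding V_def using that by (intro SUP_upper2[of S] SUP_upper2[of T]) auto
    then show ?thesis by simp
  qed
  have Vsub: "V \<subseteq> \<Union>\<S>"
  proof
    fix x assume "x \<in> V"
    then obtain S T where ST: "S \<in> \<S>" "T \<in> \<S>" "S \<inter> T \<noteq> {}" "x \<in> {fst (e S T), snd (e S T)}"
      unfolding V_def by (auto split: if_splits)
    then have "x \<in> S \<inter> T" using e[OF ST(1-3)] by auto
    then show "x \<in> \<Union>\<S>" using ST by auto
  qed
  define \<E> where "\<E> = {open_segment u v | u v S. S \<in> \<S> \<and>
      u \<in> V \<and> v \<in> V \<and> u \<in> S \<and> v \<in> S \<and> u \<noteq> v \<and> open_segment u v \<inter> V = {}}"
  have "\<E> \<subseteq> (\<lambda>(u, v). open_segment u v) ` (V \<times> V)" unfolding \<E>_def by auto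
  then have fin\<E>: "finite \<E>" using finV by (meson finite_SigmaI finite_imageI finite_subset)
  have eqI: "E = E'" if x: "E \<in> \<E>" "E' \<in> \<E>" "x \<in> E" "x \<in> E'" for E E' x
  proof -
    obtain S u v where E: "S \<in> \<S>" "E = open_segment u v" "u \<in> V" "v \<in> V" "u \<in> S" "v \<in> S"
      "E \<inter> V = {}" using x(1) unfolding \<E>_def by blast
    obtain T p r where E': "T \<in> \<S>" "E' = open_segment p r" "p \<in> V" "r \<in> V" "p \<in> T" "r \<in> T"
      "E' \<inter> V = {}" using x(2) unfolding \<E>_def by blast
    have conv: "convex S" "convex T" and col: "collinear S" "collinear T"
      using seg E(1) E'(1) by (auto simp: seg_def)
    have xS: "x \<in> S" using x(3) E conv(1) by (meson convex_contains_open_segment subsetD)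
    have xT: "x \<in> T" using x(4) E' conv(2) by (meson convex_contains_open_segment subsetD)
    have ne: "S \<inter> T \<noteq> {}" using xS xT by blast
    define y z where "y = fst (e S T)" and "z = snd (e S T)"
    have ST: "S \<inter> T = closed_segment y z" using e[OF E(1) E'(1) ne] by (simp add: y_def z_def)
    have yz: "y \<in> V" "z \<in> V" using endsV[OF E(1) E'(1) ne] by (auto simp: y_def z_def)
    \<comment> \<open>The first edge cannot leave \<open>S \<inter> T\<close>, so both edges lie on the line through \<open>T\<close>.\<close>
    have "u \<in> closed_segment y z \<and> v \<in> closed_segment y z"
      using open_segment_trapped[OF col(1) E(5,6), of y z x] x(3) E xS xT yz ST by auto
    then have "u \<in> T" "v \<in> T" using ST by auto
    then show ?thesis
      unfolding E(2) E'(2)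
      by (intro open_segments_eq[OF col(2), of u v p r x]) (use E E' x in auto)
  qed
  have cover: "\<Union>\<E> = \<Union>\<S> - V"
  proof
    show "\<Union>\<E> \<subseteq> \<Union>\<S> - V"
    proof
      fix x assume "x \<in> \<Union>\<E>"
      then obtain S u v where *: "S \<in> \<S>" "x \<in> open_segment u v" "u \<in> S" "v \<in> S"
        "open_segment u v \<inter> V = {}" unfolding \<E>_def by blast
      then have "x \<in> S" using seg[of S] unfolding seg_def
        by (meson convex_contains_open_segment subsetD)
      with * show "x \<in> \<Union>\<S> - V" by auto
    qed
    show "\<Union>\<S> - V \<subseteq> \<Union>\<E>"
    proof
      fix x assume x: "x \<in> \<Union>\<S> - V"
      then obtain S where S: "S \<in> \<S>" "x \<in> S" by blast
      then have cs: "S = closed_segment (fst (e S S)) (snd (e S S))" using e[of S S] by auto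
      have ends: "fst (e S S) \<in> V" "snd (e S S) \<in> V" using endsV[of S S] S by auto
      have "x \<in> closed_segment (fst (e S S)) (snd (e S S))" using cs S(2) by metis
      from gap_around_point[OF finV ends this] x
      obtain u v where "u \<in> V" "v \<in> V" "u \<in> S" "v \<in> S" "x \<in> open_segment u v"
        "open_segment u v \<inter> V = {}" using cs by (metis DiffD2)
      moreover from this have "u \<noteq> v" by auto
      ultimately have "open_segment u v \<in> \<E>" unfolding \<E>_def using S(1) by blast
      then show "x \<in> \<Union>\<E>" using \<open>x \<in> open_segment u v\<close> by blast
    qed
  qed
  \<comment> \<open>An edge is open because the vertices and the other edges together form a closed set.\<close>
  have cl: "closed (E \<union> V)" if EE: "E \<in> \<E>" for E
  proof -
    obtain u v where E: "E = open_segment u v" "u \<in> V" "v \<in> V" using EE unfolding \<E>_def by blast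
    then have "E \<union> V = closed_segment u v \<union> V" by (auto simp: open_segment_def)
    then show ?thesis using finV by (simp add: closed_Un finite_imp_closed)
  qed
  have edge: "openin (top_of_set (\<Union>\<S>)) E \<and> (\<exists>I :: real set. open I \<and> is_interval I \<and> I \<noteq> {} \<and>
      subtopology (top_of_set (\<Union>\<S>)) E homeomorphic_space top_of_set I)" if EE: "E \<in> \<E>" for E
  proof
    have "E = \<Union>\<S> \<inter> - (V \<union> (\<Union>E'\<in>\<E> - {E}. E' \<union> V))"
    proof (intro equalityI subsetI)
      fix x assume x: "x \<in> E"
      then have "x \<in> \<Union>\<S> - V" using EE unfolding cover[symmetric] by blast
      moreover have "x \<notin> E'" if "E' \<in> \<E> - {E}" for E'
        using eqI[OF EE _ x, of E'] that by blast
      ultimately show "x \<in> \<Union>\<S> \<inter> - (V \<union> (\<Union>E'\<in>\<E> - {E}. E' \<union> V))" by blast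
    next
      fix x assume x: "x \<in> \<Union>\<S> \<inter> - (V \<union> (\<Union>E'\<in>\<E> - {E}. E' \<union> V))"
      then have "x \<in> \<Union>\<E>" unfolding cover by blast
      then show "x \<in> E" using x by blast
    qed
    moreover have "closed (V \<union> (\<Union>E'\<in>\<E> - {E}. E' \<union> V))"
      using finV fin\<E> cl by (intro closed_Un closed_UN) (auto simp: finite_imp_closed)
    ultimately show "openin (top_of_set (\<Union>\<S>)) E" by (metis openin_open_Int open_Compl)
    obtain u v where E: "E = open_segment u v" "u \<noteq> v" using EE unfolding \<E>_def by blast
    have "\<Union>\<S> \<inter> E = E" using cover EE by blast
    then show "\<exists>I :: real set. open I \<and> is_interval I \<and> I \<noteq> {} \<and>
      subtopology (top_of_set (\<Union>\<S>)) E homeomorphic_space top_of_set I"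
      using open_segment_homeomorphic_interval[OF E(2)] by (simp add: subtopology_subtopology E(1))
  qed
  have "compact (\<Union>\<S>)" using fin seg by (intro compact_Union) (auto simp: seg_def)
  then have "compact_space (top_of_set (\<Union>\<S>))" by (simp add: compact_space_subtopology)
  moreover have "disjoint \<E>" using eqI by (meson disjointI disjoint_iff)
  ultimately have "graph (top_of_set (\<Union>\<S>)) V"
    unfolding graph_def topspace_euclidean_subtopology
    using finV Vsub fin\<E> cover edge Hausdorff_space_subtopology[OF Hausdorff_space_euclidean]
    by (intro conjI exI[of _ \<E>] ballI) simp_all
  then show ?thesis ..
qed

section \<open>Affine maps and iterated compositions\<close>

lemma seg_line_Int:
  assumes "compact C" "convex C"
  shows "seg (line base d \<inter> C)"
proof -
  have "collinear (line base d)" unfolding collinear_alt line_def by blast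
  then show ?thesis
    unfolding seg_def using assms closed_line convex_line
    by (metis closed_Int_compact collinear_subset convex_Int inf_le1)
qed

definition affine_map :: "('a::real_vector \<Rightarrow> 'b::real_vector) \<Rightarrow> bool" where
  "affine_map f \<longleftrightarrow> (\<exists>L c. linear L \<and> f = (\<lambda>z. c + L z))"

lemma affine_map_image_line:
  assumes "affine_map f"
  obtains base' d' where "f ` line base d = line base' d'"
proof -
  obtain L c where L: "linear L" "f = (\<lambda>z. c + L z)" using assms unfolding affine_map_def by blast
  have "f (base + t *\<^sub>R d) = f base + t *\<^sub>R L d" for t
    by (simp add: L(2) linear_add[OF L(1)] linear_scale[OF L(1)])
  then show thesis by (intro that[of "f base" "L d"]) (simp add: line_def image_image)
qed

lemma affine_map_image:
  fixes f :: "'a::euclidean_space \<Rightarrow> 'b::euclidean_space"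
  assumes "affine_map f"
  shows "compact C \<Longrightarrow> compact (f ` C)" "convex C \<Longrightarrow> convex (f ` C)" "seg C \<Longrightarrow> seg (f ` C)"
proof -
  obtain L c where L: "linear L" "f = (\<lambda>z. c + L z)" using assms unfolding affine_map_def by blast
  have comp: "compact (f ` C)" if "compact C" for C
    unfolding L(2) using that L(1)
    by (intro compact_continuous_image continuous_intros linear_continuous_on) (simp_all add: linear_conv_bounded_linear)
  have conv: "convex (f ` C)" if "convex C" for C
    using that L(1) unfolding L(2) by (metis convex_linear_image convex_translation image_image)
  show "compact C \<Longrightarrow> compact (f ` C)" "convex C \<Longrightarrow> convex (f ` C)" by (fact comp conv)+
  assume C: "seg C"
  then obtain u v where uv: "\<And>x. x \<in> C \<Longrightarrow> \<exists>k. x = u + k *\<^sub>R v" unfolding seg_def collinear_alt by blast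
  have "\<exists>k. f x = f u + k *\<^sub>R L v" if x: "x \<in> C" for x
  proof -
    obtain k where "x = u + k *\<^sub>R v" using uv[OF x] by blast
    then show ?thesis by (auto simp add: L(2) linear_add[OF L(1)] linear_scale[OF L(1)])
  qed
  then have "collinear (f ` C)" unfolding collinear_alt by blast
  then show "seg (f ` C)" using C comp conv unfolding seg_def by blast
qed

primrec compose_upto :: "(nat \<Rightarrow> 'a \<Rightarrow> 'a) \<Rightarrow> nat \<Rightarrow> 'a \<Rightarrow> 'a" where
  "compose_upto A 0 = id"
| "compose_upto A (Suc n) = A n \<circ> compose_upto A n"

lemma compose_upto_periodic:
  assumes "\<And>n. A (n + m) = A n"
  shows "compose_upto A (m * k) = compose_upto A m ^^ k"
proof (induction k)
  case (Suc k)
  have per: "A (n + m * k) = A n" for n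
  proof (induction k)
    case (Suc k)
    then show ?case using assms[of "n + m * k"] by (simp add: algebra_simps)
  qed simp
  have "compose_upto A (n + m * k) = compose_upto A n \<circ> compose_upto A (m * k)" for n
    by (induction n) (simp_all add: per comp_assoc)
  from this[of m] show ?case by (simp add: Suc)
qed simp

lemma homothety_funpow:
  fixes c :: "'a::real_vector"
  assumes "\<And>z. h z = c + \<mu> *\<^sub>R (z - c)"
  shows "(h ^^ k) z = c + \<mu> ^ k *\<^sub>R (z - c)"
proof (induction k)
  case (Suc k)
  then show ?case using assms[of "(h ^^ k) z"] by simp
qed simp

section \<open>Segments under a map with affine branches\<close>

locale absorbing =
  fixes f :: "'a::euclidean_space \<Rightarrow> 'a" and X K :: "'a set"
  assumes X: "compact X" "f ` X \<subseteq> X"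
begin

text \<open>
  A set is tame if it lies in a finite union of segments that the map keeps invariant up to points
  of \<open>K\<close>. In the application \<open>K\<close> consists of two segments; once these are known to be tame, the
  exception disappears. The exception makes it possible to work backwards along the dynamics:
  an orbit has to be followed only until its first visit to \<open>K\<close>.
\<close>

definition tame :: "'a set \<Rightarrow> bool" where
  "tame T \<longleftrightarrow> (\<exists>\<S>. finite \<S> \<and> (\<forall>S\<in>\<S>. seg S) \<and> T \<subseteq> \<Union>\<S> \<and> f ` \<Union>\<S> \<subseteq> \<Union>\<S> \<union> K)"

text \<open>
  The condition on segments controls the graph, the condition on points controls absorption into
  it; both propagate backwards along the dynamics by the same arguments. In the application \<open>E\<close>
  consists of centres of expanding loops, whose orbits need not meet \<open>K\<close>.
\<close>

definition tame_region :: "'a set \<Rightarrow> bool" where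
  "tame_region Z \<longleftrightarrow> (\<forall>S. seg S \<longrightarrow> S \<subseteq> X \<longrightarrow> tame (S \<inter> Z)) \<and>
     (\<exists>E. finite E \<and> E \<subseteq> X \<and> (\<forall>z\<in>Z. \<exists>n. (f ^^ n) z \<in> K \<union> E))"

lemma tame_subset: "tame T \<Longrightarrow> T' \<subseteq> T \<Longrightarrow> tame T'"
  unfolding tame_def by (meson order_trans)

lemma tame_UN:
  assumes "finite I" "\<And>i. i \<in> I \<Longrightarrow> tame (T i)"
  shows "tame (\<Union>i\<in>I. T i)"
proof -
  have "\<forall>i\<in>I. \<exists>\<S>. finite \<S> \<and> (\<forall>S\<in>\<S>. seg S) \<and> T i \<subseteq> \<Union>\<S> \<and> f ` \<Union>\<S> \<subseteq> \<Union>\<S> \<union> K"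
    using assms(2) unfolding tame_def by blast
  then obtain \<S> where \<S>: "\<forall>i\<in>I. finite (\<S> i) \<and> (\<forall>S\<in>\<S> i. seg S) \<and> T i \<subseteq> \<Union>(\<S> i) \<and>
      f ` \<Union>(\<S> i) \<subseteq> \<Union>(\<S> i) \<union> K"
    unfolding bchoice_iff by blast
  show ?thesis
    unfolding tame_def
  proof (intro exI[of _ "\<Union>i\<in>I. \<S> i"] conjI)
    show "finite (\<Union>i\<in>I. \<S> i)" using assms(1) \<S> by simp
    show "\<forall>S\<in>\<Union>i\<in>I. \<S> i. seg S" using \<S> by simp
    show "(\<Union>i\<in>I. T i) \<subseteq> \<Union>(\<Union>i\<in>I. \<S> i)"
    proof
      fix y assume "y \<in> (\<Union>i\<in>I. T i)"
      then obtain i where i: "i \<in> I" "y \<in> T i" by blast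
      have "T i \<subseteq> \<Union>(\<S> i)" using \<S> i(1) by simp
      then have "y \<in> \<Union>(\<S> i)" using i(2) by (rule subsetD)
      with i(1) show "y \<in> \<Union>(\<Union>i\<in>I. \<S> i)" by blast
    qed
    show "f ` \<Union>(\<Union>i\<in>I. \<S> i) \<subseteq> \<Union>(\<Union>i\<in>I. \<S> i) \<union> K"
    proof
      fix y assume "y \<in> f ` \<Union>(\<Union>i\<in>I. \<S> i)"
      then obtain i where i: "i \<in> I" "y \<in> f ` \<Union>(\<S> i)" by blast
      have "f ` \<Union>(\<S> i) \<subseteq> \<Union>(\<S> i) \<union> K" using \<S> i(1) by simp
      then have "y \<in> \<Union>(\<S> i) \<union> K" using i(2) by (rule subsetD)
      with i(1) show "y \<in> \<Union>(\<Union>i\<in>I. \<S> i) \<union> K" by blast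
    qed
  qed
qed

lemma tame_Un: "tame S \<Longrightarrow> tame T \<Longrightarrow> tame (S \<union> T)"
  using tame_UN[of "{S, T}" "\<lambda>i. i"] by auto

text \<open>
  The images of the family may fall back into the family; this is how cycles of segments are closed.
\<close>

lemma tame_family:
  assumes "finite \<T>" "\<And>T. T \<in> \<T> \<Longrightarrow> seg T" "f ` \<Union>\<T> \<subseteq> \<Union>\<T> \<union> R \<union> K" "tame R"
  shows "tame (\<Union>\<T>)"
proof -
  obtain \<S> where \<S>: "finite \<S>" "\<forall>S\<in>\<S>. seg S" "R \<subseteq> \<Union>\<S>" "f ` \<Union>\<S> \<subseteq> \<Union>\<S> \<union> K"
    using assms(4) unfolding tame_def by blast
  show ?thesis
    unfolding tame_def
  proof (intro exI[of _ "\<T> \<union> \<S>"] conjI)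
    show "f ` \<Union>(\<T> \<union> \<S>) \<subseteq> \<Union>(\<T> \<union> \<S>) \<union> K"
      using assms(3) \<S>(3,4) unfolding Union_Un_distrib image_Un by blast
  qed (use assms(1,2) \<S>(1,2) in auto)
qed

lemma tame_regionI:
  assumes "\<And>S. seg S \<Longrightarrow> S \<subseteq> X \<Longrightarrow> tame (S \<inter> Z)"
    and "\<exists>E. finite E \<and> E \<subseteq> X \<and> (\<forall>z\<in>Z. \<exists>n. (f ^^ n) z \<in> K \<union> E)"
  shows "tame_region Z"
  unfolding tame_region_def using assms by simp

lemma tame_regionD: "tame_region Z \<Longrightarrow> seg S \<Longrightarrow> S \<subseteq> X \<Longrightarrow> tame (S \<inter> Z)"
  unfolding tame_region_def by simp

lemma tame_region_obtain_finite:
  assumes "tame_region Z"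
  obtains E where "finite E" "E \<subseteq> X" "\<And>z. z \<in> Z \<Longrightarrow> \<exists>n. (f ^^ n) z \<in> K \<union> E"
  using assms unfolding tame_region_def by metis

lemma tame_region_subset:
  assumes Z: "tame_region Z" and "Z' \<subseteq> Z"
  shows "tame_region Z'"
proof (rule tame_regionI)
  fix S assume "seg S" "S \<subseteq> X"
  from tame_regionD[OF Z this] show "tame (S \<inter> Z')" by (rule tame_subset) (use assms(2) in blast)
next
  obtain E where "finite E" "E \<subseteq> X" "\<And>z. z \<in> Z \<Longrightarrow> \<exists>n. (f ^^ n) z \<in> K \<union> E"
    using tame_region_obtain_finite[OF Z] by blast
  then show "\<exists>E. finite E \<and> E \<subseteq> X \<and> (\<forall>z\<in>Z'. \<exists>n. (f ^^ n) z \<in> K \<union> E)"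
    using assms(2) by (intro exI[of _ E]) auto
qed

lemma tame_region_Un:
  assumes Y: "tame_region Y" and Z: "tame_region Z"
  shows "tame_region (Y \<union> Z)"
proof (rule tame_regionI)
  fix S assume "seg S" "S \<subseteq> X"
  from tame_Un[OF tame_regionD[OF Y this] tame_regionD[OF Z this]]
  show "tame (S \<inter> (Y \<union> Z))" by (simp add: Int_Un_distrib)
next
  obtain E where E: "finite E" "E \<subseteq> X" "\<And>z. z \<in> Y \<Longrightarrow> \<exists>n. (f ^^ n) z \<in> K \<union> E"
    using tame_region_obtain_finite[OF Y] by blast
  obtain E' where E': "finite E'" "E' \<subseteq> X" "\<And>z. z \<in> Z \<Longrightarrow> \<exists>n. (f ^^ n) z \<in> K \<union> E'"
    using tame_region_obtain_finite[OF Z] by blast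
  have "\<exists>n. (f ^^ n) z \<in> K \<union> (E \<union> E')" if "z \<in> Y \<union> Z" for z
    using that E(3)[of z] E'(3)[of z] by blast
  then show "\<exists>E. finite E \<and> E \<subseteq> X \<and> (\<forall>z\<in>Y \<union> Z. \<exists>n. (f ^^ n) z \<in> K \<union> E)"
    using E(1,2) E'(1,2) by (intro exI[of _ "E \<union> E'"]) auto
qed

lemma tame_region_collapsed:
  assumes Y: "compact Y" "convex Y" and fY: "f ` Y \<subseteq> K"
  shows "tame_region Y"
proof (rule tame_regionI)
  show "tame (S \<inter> Y)" if "seg S" for S
    unfolding tame_def using seg_Int[OF that Y] fY by (intro exI[of _ "{S \<inter> Y}"]) auto
  have "(f ^^ 1) z \<in> K \<union> {}" if "z \<in> Y" for z using fY that by auto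
  then show "\<exists>E. finite E \<and> E \<subseteq> X \<and> (\<forall>z\<in>Y. \<exists>n. (f ^^ n) z \<in> K \<union> E)"
    by (intro exI[of _ "{}"]) blast
qed

lemma tame_region_step:
  assumes Y: "compact Y" "convex Y" and A: "affine_map A" "\<And>z. z \<in> Y \<Longrightarrow> f z = A z"
    and Z: "tame_region Z" "f ` Y \<subseteq> Z"
  shows "tame_region Y"
proof (rule tame_regionI)
  show "tame (S \<inter> Y)" if S: "seg S" "S \<subseteq> X" for S
  proof -
    have im: "f ` (S \<inter> Y) = A ` (S \<inter> Y)" using A(2) by auto
    have "seg (f ` (S \<inter> Y))"
      unfolding im by (rule affine_map_image(3)[OF A(1) seg_Int[OF S(1) Y]])
    moreover have "f ` (S \<inter> Y) \<subseteq> X" using S(2) X(2) by blast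
    ultimately have "tame (f ` (S \<inter> Y) \<inter> Z)" by (rule tame_regionD[OF Z(1)])
    then have "tame (\<Union>{S \<inter> Y})"
      by (rule tame_family[rotated 3]) (use Z(2) seg_Int[OF S(1) Y] in auto)
    then show ?thesis by simp
  qed
  obtain E where E: "finite E" "E \<subseteq> X" "\<And>z. z \<in> Z \<Longrightarrow> \<exists>n. (f ^^ n) z \<in> K \<union> E"
    using tame_region_obtain_finite[OF Z(1)] by blast
  have "\<exists>n. (f ^^ n) z \<in> K \<union> E" if "z \<in> Y" for z
  proof -
    have "f z \<in> Z" using Z(2) that by blast
    then obtain n where "(f ^^ n) (f z) \<in> K \<union> E" using E(3) by blast
    then have "(f ^^ Suc n) z \<in> K \<union> E" by (simp only: funpow_Suc_right comp_apply)
    then show ?thesis by blast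
  qed
  then show "\<exists>E. finite E \<and> E \<subseteq> X \<and> (\<forall>z\<in>Y. \<exists>n. (f ^^ n) z \<in> K \<union> E)"
    using E(1,2) by blast
qed

text \<open>
  Regions \<open>Y 0, Y 1, \<dots>\<close> are visited cyclically by orbits that do not leave for \<open>Z\<close>, and the return
  map after \<open>m\<close> steps has a power that is a homothety with centre \<open>c\<close> and ratio of modulus greater
  than 1; such a power exists when the return map rotates by a rational angle. A line through \<open>c\<close>
  is mapped into itself by this power, so it produces finitely many lines. A line that misses \<open>c\<close>
  recedes from \<open>c\<close> and leaves the bounded set \<open>X\<close> after finitely many turns. In both cases the
  images of a segment along the loop lie in finitely many segments. For points the same expansion
  shows that only \<open>c\<close> can stay in the loop for ever; if \<open>c\<close> is outside \<open>Y 0\<close>, all points leave it.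
\<close>

lemma tame_region_loop:
  fixes Y :: "nat \<Rightarrow> 'a set" and A :: "nat \<Rightarrow> 'a \<Rightarrow> 'a" and c :: 'a and \<mu> :: real
  assumes Y: "\<And>n. compact (Y n)" "\<And>n. convex (Y n)" "\<And>n. Y n \<subseteq> X"
    and A: "\<And>n. affine_map (A n)" "\<And>n z. z \<in> Y n \<Longrightarrow> f z = A n z"
    and step: "\<And>n z. z \<in> Y n \<Longrightarrow> f z \<in> Y (Suc n) \<union> Z" and Z: "tame_region Z"
    and per: "m > 0" "\<And>n. A (n + m) = A n" "\<And>n. Y (n + m) = Y n"
    and hom: "j > 0" "\<And>z. (compose_upto A m ^^ j) z = c + \<mu> *\<^sub>R (z - c)" "\<bar>\<mu>\<bar> > 1"
  shows "tame_region (Y 0)"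
proof -
  have ret: "compose_upto A (m * (j * k)) z = c + \<mu> ^ k *\<^sub>R (z - c)" for k z
  proof -
    have "compose_upto A (m * (j * k)) = compose_upto A m ^^ (j * k)"
      by (rule compose_upto_periodic) (rule per(2))
    also have "\<dots> = (compose_upto A m ^^ j) ^^ k" by (simp add: funpow_mult mult.commute)
    finally show ?thesis using homothety_funpow[of "compose_upto A m ^^ j" c \<mu>, OF hom(2)] by simp
  qed
  have Yper: "Y (m * k) = Y 0" for k
  proof (induction k)
    case (Suc k)
    then show ?case using per(3)[of "m * k"] by (simp add: algebra_simps)
  qed simp
  obtain R where R: "\<And>x. x \<in> X \<Longrightarrow> norm (x - c) \<le> R"
    using X(1) compact_imp_bounded bounded_any_center[of X c]
    by (metis dist_norm norm_minus_commute)
  have escape: "\<exists>k>0. R < \<bar>\<mu>\<bar> ^ k * r" if r: "r > 0" for r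
  proof -
    obtain k where "R / r < \<bar>\<mu>\<bar> ^ k" using real_arch_pow[OF hom(3)] by blast
    also have "\<dots> \<le> \<bar>\<mu>\<bar> ^ Suc k" using hom(3) by (intro power_increasing) auto
    finally have "R < \<bar>\<mu>\<bar> ^ Suc k * r" using r by (simp add: pos_divide_less_eq)
    then show ?thesis by blast
  qed
  show ?thesis
  proof (rule tame_regionI)
    fix S assume S: "seg S" "S \<subseteq> X"
    obtain base d where S': "S \<subseteq> line base d"
      using collinear_obtain_line S(1) unfolding seg_def by metis
    define T where "T = (\<lambda>n. compose_upto A n ` line base d \<inter> Y n)"
    have "\<exists>base' d'. compose_upto A n ` line base d = line base' d'" for n
    proof (induction n)
      case (Suc n)
      then obtain base' d' where "compose_upto A n ` line base d = line base' d'" by blast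
      then have "compose_upto A (Suc n) ` line base d = A n ` line base' d'"
        unfolding compose_upto.simps image_comp[symmetric] by simp
      then show ?case using affine_map_image_line[OF A(1)] by metis
    qed auto
    then have segT: "seg (T n)" for n unfolding T_def by (metis seg_line_Int Y(1,2))
    \<comment> \<open>The traces on the regions of the images of the line repeat or die out.\<close>
    have "\<exists>N>0. T N \<subseteq> T 0"
    proof (cases "c \<in> line base d")
      case True
      then obtain s where s: "c = base + s *\<^sub>R d" unfolding line_def by blast
      have "c + \<mu> *\<^sub>R (base + t *\<^sub>R d - c) = base + (s + \<mu> * (t - s)) *\<^sub>R d" for t
        unfolding s by (simp add: algebra_simps)
      then have "(\<lambda>z. c + \<mu> *\<^sub>R (z - c)) ` line base d \<subseteq> line base d"
        unfolding line_def by auto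
      moreover have "compose_upto A (m * j) = (\<lambda>z. c + \<mu> *\<^sub>R (z - c))"
        using ret[of 1] by (intro ext) simp
      ultimately have "T (m * j) \<subseteq> T 0" unfolding T_def Yper by auto
      then show ?thesis using per(1) hom(1) by (intro exI[of _ "m * j"]) simp
    next
      case False
      have "line base d \<noteq> {}" by (simp add: line_def)
      then have "infdist c (line base d) > 0"
        using False closed_line in_closed_iff_infdist_zero infdist_nonneg
        by (metis less_eq_real_def)
      from escape[OF this] obtain k where k: "k > 0" "R < \<bar>\<mu>\<bar> ^ k * infdist c (line base d)" by blast
      have "x \<notin> T (m * (j * k))" for x
      proof
        assume "x \<in> T (m * (j * k))"
        then obtain z where z: "z \<in> line base d" "x = c + \<mu> ^ k *\<^sub>R (z - c)" "x \<in> X"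
          unfolding T_def ret[abs_def] using Y(3) by auto
        have "\<bar>\<mu>\<bar> ^ k * infdist c (line base d) \<le> \<bar>\<mu>\<bar> ^ k * norm (z - c)"
          using infdist_le[OF z(1), of c] by (intro mult_left_mono) (simp_all add: dist_norm norm_minus_commute)
        also have "\<dots> = norm (x - c)" unfolding z(2) by (simp add: power_abs)
        also have "\<dots> \<le> R" using R z(3) by blast
        finally show False using k(2) by simp
      qed
      then show ?thesis using k(1) per(1) hom(1) by (intro exI[of _ "m * (j * k)"]) auto
    qed
    then obtain N where N: "N > 0" "T N \<subseteq> T 0" by blast
    define R' where "R' = (\<Union>n\<in>{..<N}. A n ` T n \<inter> Z)"
    have fT: "f ` T n = A n ` T n" for n by (intro image_cong refl A(2)) (simp add: T_def)
    have "tame (A n ` T n \<inter> Z)" for n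
    proof -
      have "seg (A n ` T n)" by (rule affine_map_image(3)[OF A(1) segT])
      moreover have "A n ` T n \<subseteq> X" using fT[of n] X(2) Y(3)[of n] unfolding T_def by blast
      ultimately show ?thesis by (rule tame_regionD[OF Z])
    qed
    then have R': "tame R'" unfolding R'_def by (intro tame_UN) auto
    have step': "f ` T n \<subseteq> T (Suc n) \<union> (A n ` T n \<inter> Z)" for n
    proof
      fix y assume y: "y \<in> f ` T n"
      then obtain z where z: "z \<in> T n" "y = f z" by blast
      have "y \<in> A n ` T n" using y fT by blast
      moreover have "y \<in> Y (Suc n) \<union> Z" using step z unfolding T_def by blast
      moreover have "y \<in> compose_upto A (Suc n) ` line base d"
        using z A(2)[of z n] unfolding T_def by auto
      ultimately show "y \<in> T (Suc n) \<union> (A n ` T n \<inter> Z)" unfolding T_def by blast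
    qed
    have "tame (\<Union>(T ` {..<N}))"
    proof (rule tame_family[OF _ _ _ R'])
      have next_T: "T (Suc n) \<subseteq> \<Union>(T ` {..<N})" if "n < N" for n
      proof (cases "Suc n < N")
        case False
        then have "Suc n = N" using that by linarith
        then have "T (Suc n) \<subseteq> T 0" using N(2) by (simp only:)
        also have "\<dots> \<subseteq> \<Union>(T ` {..<N})" using N(1) by (intro UN_upper) simp
        finally show ?thesis .
      qed (intro UN_upper, simp)
      have "f ` T n \<subseteq> \<Union>(T ` {..<N}) \<union> R'" if "n < N" for n
      proof -
        have "A n ` T n \<inter> Z \<subseteq> R'" unfolding R'_def using that by (intro UN_upper) simp
        with step'[of n] next_T[OF that] show ?thesis by blast
      qed
      then show "f ` \<Union>(T ` {..<N}) \<subseteq> \<Union>(T ` {..<N}) \<union> R' \<union> K"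
        unfolding image_UN by (intro UN_least) blast
    qed (use segT in auto)
    moreover have "S \<inter> Y 0 \<subseteq> T 0" using S' by (auto simp: T_def)
    then have "S \<inter> Y 0 \<subseteq> \<Union>(T ` {..<N})" using N(1) by (intro SUP_upper2[of 0]) simp_all
    ultimately show "tame (S \<inter> Y 0)" by (rule tame_subset)
  next
    obtain E where E: "finite E" "E \<subseteq> X" "\<And>z. z \<in> Z \<Longrightarrow> \<exists>n. (f ^^ n) z \<in> K \<union> E"
      using tame_region_obtain_finite[OF Z] by blast
    have "\<exists>n. (f ^^ n) z \<in> K \<union> (E \<union> ({c} \<inter> Y 0))" if z: "z \<in> Y 0" for z
    proof (cases "\<exists>n. (f ^^ n) z \<in> Z")
      case True
      then obtain n where "(f ^^ n) z \<in> Z" by blast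
      then obtain k where "(f ^^ k) ((f ^^ n) z) \<in> K \<union> E" using E(3) by blast
      then have "(f ^^ (k + n)) z \<in> K \<union> E" by (simp add: funpow_add)
      then show ?thesis by blast
    next
      case False
      have orbit: "(f ^^ n) z \<in> Y n \<and> (f ^^ n) z = compose_upto A n z" for n
      proof (induction n)
        case (Suc n)
        then have "f ((f ^^ n) z) \<in> Y (Suc n) \<union> Z" using step by blast
        moreover have "f ((f ^^ n) z) \<notin> Z" using False by (metis funpow.simps(2) comp_apply)
        ultimately show ?case using Suc A(2)[of "(f ^^ n) z" n] by auto
      qed (use z in auto)
      have "z = c"
      proof (rule ccontr)
        assume "z \<noteq> c"
        then obtain k where k: "R < \<bar>\<mu>\<bar> ^ k * norm (z - c)" using escape[of "norm (z - c)"] by auto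
        have "compose_upto A (m * (j * k)) z \<in> X" using orbit Y(3) by (metis subsetD)
        then have "norm (\<mu> ^ k *\<^sub>R (z - c)) \<le> R" using R unfolding ret by force
        then show False using k by (simp add: power_abs)
      qed
      then have "(f ^^ 0) z \<in> K \<union> (E \<union> ({c} \<inter> Y 0))" using z by simp
      then show ?thesis by blast
    qed
    moreover have "finite (E \<union> ({c} \<inter> Y 0))" "E \<union> ({c} \<inter> Y 0) \<subseteq> X" using E(1,2) Y(3) by auto
    ultimately show "\<exists>E. finite E \<and> E \<subseteq> X \<and> (\<forall>z\<in>Y 0. \<exists>n. (f ^^ n) z \<in> K \<union> E)"
      by blast
  qed
qed

text \<open>
  The segments of \<open>K\<close> are themselves tame, and so are the points of \<open>E\<close>, being degenerate segments.
  A family that covers all of them swallows the exceptional points in \<open>K\<close>.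
\<close>

lemma tame_region_imp_invariant_segments:
  assumes X': "tame_region X" and K: "finite \<K>" "\<And>S. S \<in> \<K> \<Longrightarrow> seg S" "K = \<Union>\<K>" "K \<subseteq> X"
  obtains \<S> where "finite \<S>" "\<And>S. S \<in> \<S> \<Longrightarrow> seg S" "f ` \<Union>\<S> \<subseteq> \<Union>\<S>"
    "\<And>z. z \<in> X \<Longrightarrow> \<exists>n. (f ^^ n) z \<in> \<Union>\<S>"
proof -
  obtain E where E: "finite E" "E \<subseteq> X" "\<And>z. z \<in> X \<Longrightarrow> \<exists>n. (f ^^ n) z \<in> K \<union> E"
    using tame_region_obtain_finite[OF X'] by blast
  define I where "I = \<K> \<union> (\<lambda>e. {e}) ` E"
  have "seg S \<and> S \<subseteq> X" if S: "S \<in> I" for S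
    using S K E(2) unfolding I_def by (auto simp: seg_def)
  then have "tame S" if S: "S \<in> I" for S
    using tame_regionD[OF X', of S] that by (simp add: Int_absorb2)
  then have "tame (\<Union>S\<in>I. S)" using K(1) E(1) by (intro tame_UN) (auto simp: I_def)
  moreover have "(\<Union>S\<in>I. S) = K \<union> E" unfolding I_def K(3) by blast
  ultimately obtain \<S> where \<S>: "finite \<S>" "\<forall>S\<in>\<S>. seg S" "K \<union> E \<subseteq> \<Union>\<S>" "f ` \<Union>\<S> \<subseteq> \<Union>\<S> \<union> K"
    unfolding tame_def by auto
  show thesis
  proof (rule that[of \<S>])
    show "f ` \<Union>\<S> \<subseteq> \<Union>\<S>" using \<S>(3,4) by blast
    show "\<exists>n. (f ^^ n) z \<in> \<Union>\<S>" if "z \<in> X" for z using E(3) \<S>(3) that by blast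
  qed (use \<S> in auto)
qed

end

section \<open>Quadrants and the homogeneous map\<close>

definition halfplane :: "real \<Rightarrow> real \<Rightarrow> real \<Rightarrow> (real \<times> real) set" where
  "halfplane u v c = {z. (u, v) \<bullet> z \<le> c}"

lemma mem_halfplane [simp]: "(x, y) \<in> halfplane u v c \<longleftrightarrow> u * x + v * y \<le> c"
  by (simp add: halfplane_def)

lemma halfplane_closed_convex: "closed (halfplane u v c)" "convex (halfplane u v c)"
  unfolding halfplane_def by (fact closed_halfspace_le convex_halfspace_le)+

definition NE :: "(real \<times> real) set" where "NE = halfplane (-1) 0 0 \<inter> halfplane 0 (-1) 0"
definition NW :: "(real \<times> real) set" where "NW = halfplane 1 0 0 \<inter> halfplane 0 (-1) 0"
definition SW :: "(real \<times> real) set" where "SW = halfplane 1 0 0 \<inter> halfplane 0 1 0"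
definition SE :: "(real \<times> real) set" where "SE = halfplane (-1) 0 0 \<inter> halfplane 0 1 0"

lemmas quadrant_defs = NE_def NW_def SW_def SE_def

lemma quadrant_closed_convex:
  "closed NE" "convex NE" "closed NW" "convex NW" "closed SW" "convex SW" "closed SE" "convex SE"
  unfolding quadrant_defs by (simp_all add: closed_Int convex_Int halfplane_closed_convex)

lemma affine_map_pair:
  "affine_map (\<lambda>(x, y). (p * x + q * y + r, s * x + t * y + u) :: real \<times> real)"
  unfolding affine_map_def
proof (intro exI conjI)
  show "linear (\<lambda>(x, y). (p * x + q * y, s * x + t * y) :: real \<times> real)"
    by (rule linearI) (auto simp: algebra_simps)
  show "(\<lambda>(x, y). (p * x + q * y + r, s * x + t * y + u)) =
    (\<lambda>z. (r, u) + (case z of (x, y) \<Rightarrow> (p * x + q * y, s * x + t * y)))"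
    by (auto simp: fun_eq_iff)
qed

text \<open>
  For \<open>a = b = 0\<close> the map is positively homogeneous; it folds the plane onto rays on which it
  finally vanishes. By Lipschitz continuity, five iterations of the general map therefore have
  bounded image.
\<close>

lemma homogeneous_nilpotent: "(F 0 0 ^^ 5) z = (0, 0)"
proof -
  obtain x y where z: "z = (x, y)" by fastforce
  consider "0 \<le> x" "0 \<le> y" "y \<le> x" | "0 \<le> x" "0 \<le> y" "x \<le> y"
    | "x \<le> 0" "0 \<le> y" "- x \<le> y" | "x \<le> 0" "0 \<le> y" "y \<le> - x"
    | "x \<le> 0" "y \<le> 0" | "0 \<le> x" "y \<le> 0" "- y \<le> x" | "0 \<le> x" "y \<le> 0" "x \<le> - y"
    by linarith
  then show ?thesis
    by cases (simp_all add: z F_def eval_nat_numeral abs_if)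
qed

lemma F_near_homogeneous:
  "\<bar>fst ((F a b ^^ n) z) - fst ((F 0 0 ^^ n) z)\<bar> \<le> (2 ^ n - 1) * (\<bar>a\<bar> + \<bar>b\<bar>) \<and>
   \<bar>snd ((F a b ^^ n) z) - snd ((F 0 0 ^^ n) z)\<bar> \<le> (2 ^ n - 1) * (\<bar>a\<bar> + \<bar>b\<bar>)"
proof (induction n)
  case (Suc n)
  obtain x y where xy: "(F a b ^^ n) z = (x, y)" by fastforce
  obtain x' y' where xy': "(F 0 0 ^^ n) z = (x', y')" by fastforce
  define e where "e = (2 ^ n - 1) * (\<bar>a\<bar> + \<bar>b\<bar>)"
  have e: "(2 ^ Suc n - 1) * (\<bar>a\<bar> + \<bar>b\<bar>) = 2 * e + (\<bar>a\<bar> + \<bar>b\<bar>)"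
    by (simp add: e_def algebra_simps)
  have IH: "\<bar>x - x'\<bar> \<le> e" "\<bar>y - y'\<bar> \<le> e" using Suc xy xy' by (auto simp: e_def)
  have "\<bar>\<bar>x\<bar> - y + a - (\<bar>x'\<bar> - y')\<bar> \<le> 2 * e + (\<bar>a\<bar> + \<bar>b\<bar>)"
    "\<bar>x - \<bar>y\<bar> + b - (x' - \<bar>y'\<bar>)\<bar> \<le> 2 * e + (\<bar>a\<bar> + \<bar>b\<bar>)"
    using IH by linarith+
  then show ?case unfolding e by (simp add: xy xy', simp add: F_def)
qed simp

section \<open>The dynamics for negative a\<close>

locale F_map =
  fixes a b :: real
  assumes neg: "a < 0"
begin

definition radius :: real where "radius = \<bar>a\<bar> + \<bar>b\<bar>"

text \<open>
  The first half-plane contains the whole image of the map. The other constants are chosen large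
  enough for the polygon to contain the image of the fifth iterate, whose coordinates are at most
  \<open>(2 ^ 5 - 1) * radius\<close>, and such that the four quadrant branches map it into itself.
\<close>

definition trap :: "(real \<times> real) set" where
  "trap = halfplane (-1) 1 (b - a) \<inter> halfplane 1 (-1) (127 * radius) \<inter> halfplane (-1) (-1) (62 * radius) \<inter>
       halfplane 0 (-1) (63 * radius) \<inter> halfplane 1 0 (127 * radius)"

text \<open>
  The lines carry the images of the quadrants \<open>NE\<close> and \<open>SW\<close>, on which the map has rank one.
\<close>

definition K_NE :: "(real \<times> real) set" where
  "K_NE = line (a, b) (1, 1) \<inter> trap"

definition K_SW :: "(real \<times> real) set" where
  "K_SW = line (a, b) (1, -1) \<inter> trap"

lemma radius_bounds: "- a \<le> radius" "b \<le> radius" "- b \<le> radius" "b - a \<le> radius" "- b - a \<le> radius"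
  using neg by (auto simp: radius_def)

lemma trap_closed_convex: "closed trap" "convex trap"
  unfolding trap_def by (simp_all add: closed_Int convex_Int halfplane_closed_convex)

lemma compact_trap: "compact trap"
proof -
  have "(x, y) \<in> {- 300 * radius..300 * radius} \<times> {- 300 * radius..300 * radius}" if "(x, y) \<in> trap" for x y
    using that radius_bounds unfolding trap_def by auto
  then have "trap \<subseteq> {- 300 * radius..300 * radius} \<times> {- 300 * radius..300 * radius}" by fast
  then have "bounded trap" by (rule bounded_subset[rotated]) (intro bounded_Times bounded_closed_interval)
  then show ?thesis using trap_closed_convex(1) by (simp add: compact_eq_bounded_closed)
qed

lemma F_mem_halfplane: "F a b z \<in> halfplane (-1) 1 (b - a)"
  by (cases z) (auto simp: F_def)

lemma F_trap: "F a b ` trap \<subseteq> trap"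
proof
  fix w assume "w \<in> F a b ` trap"
  then obtain x y where w: "(x, y) \<in> trap" "w = F a b (x, y)" by (metis imageE surj_pair)
  then have le: "y - x \<le> b - a" "x - y \<le> 127 * radius" "- x - y \<le> 62 * radius" "- y \<le> 63 * radius" "x \<le> 127 * radius"
    by (auto simp: trap_def)
  consider "0 \<le> x" "0 \<le> y" | "x \<le> 0" "0 \<le> y" | "x \<le> 0" "y \<le> 0" | "0 \<le> x" "y \<le> 0" by linarith
  then have "\<bar>x\<bar> - y + a - (x - \<bar>y\<bar> + b) \<le> 127 * radius" "- (\<bar>x\<bar> - y + a) - (x - \<bar>y\<bar> + b) \<le> 62 * radius"
    "- (x - \<bar>y\<bar> + b) \<le> 63 * radius" "\<bar>x\<bar> - y + a \<le> 127 * radius"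
    by (cases; use le radius_bounds neg in linarith)+
  then show "w \<in> trap" using F_mem_halfplane[of "(x, y)"] by (simp add: trap_def w(2) F_def)
qed

lemma F_power5_trap: "(F a b ^^ 5) z \<in> trap"
proof -
  obtain x y where xy: "(F a b ^^ 5) z = (x, y)" by fastforce
  have "\<bar>x\<bar> \<le> 31 * radius" "\<bar>y\<bar> \<le> 31 * radius"
    using F_near_homogeneous[where n = 5, of a b z] by (simp_all add: homogeneous_nilpotent xy radius_def)
  moreover have "(x, y) = F a b ((F a b ^^ 4) z)"
    unfolding xy[symmetric] by (simp add: eval_nat_numeral)
  then have "(x, y) \<in> halfplane (-1) 1 (b - a)" using F_mem_halfplane by simp
  ultimately show ?thesis unfolding xy trap_def by auto
qed

sublocale absorbing "F a b" trap "K_NE \<union> K_SW"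
  by unfold_locales (fact compact_trap F_trap)+

text \<open>
  On the two other quadrants the map is a similarity with ratio \<open>sqrt 2\<close> that rotates by 135 and
  by 45 degrees, respectively. The fourth power of each of them is a homothety with ratio -4.
\<close>

definition nw :: "real \<times> real \<Rightarrow> real \<times> real" where "nw = (\<lambda>(x, y). (- x - y + a, x - y + b))"
definition se :: "real \<times> real \<Rightarrow> real \<times> real" where "se = (\<lambda>(x, y). (x - y + a, x + y + b))"

lemma affine_nw: "affine_map nw"
  using affine_map_pair[of "-1" "-1" a 1 "-1" b] by (simp add: nw_def)

lemma affine_se: "affine_map se"
  using affine_map_pair[of 1 "-1" a 1 1 b] by (simp add: se_def)

lemma F_NW: "z \<in> NW \<Longrightarrow> F a b z = nw z"
  by (cases z) (simp add: quadrant_defs F_def nw_def)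

lemma F_SE: "z \<in> SE \<Longrightarrow> F a b z = se z"
  by (cases z) (simp add: quadrant_defs F_def se_def)

lemma trap_quadrants: "trap = trap \<inter> NE \<union> trap \<inter> NW \<union> trap \<inter> SW \<union> trap \<inter> SE"
  by (auto simp: quadrant_defs)

lemma tame_region_NE: "tame_region (trap \<inter> NE)"
proof (rule tame_region_collapsed)
  show "F a b ` (trap \<inter> NE) \<subseteq> K_NE \<union> K_SW"
  proof
    fix w assume "w \<in> F a b ` (trap \<inter> NE)"
    then obtain x y where w: "(x, y) \<in> trap" "(x, y) \<in> NE" "w = F a b (x, y)" by auto
    have "w = (a, b) + (x - y) *\<^sub>R (1, 1)" using w by (auto simp: F_def quadrant_defs)
    then show "w \<in> K_NE \<union> K_SW" using F_trap w(1,3) unfolding K_NE_def line_def by blast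
  qed
qed (intro compact_Int_closed convex_Int compact_trap trap_closed_convex quadrant_closed_convex)+

lemma tame_region_SW: "tame_region (trap \<inter> SW)"
proof (rule tame_region_collapsed)
  show "F a b ` (trap \<inter> SW) \<subseteq> K_NE \<union> K_SW"
  proof
    fix w assume "w \<in> F a b ` (trap \<inter> SW)"
    then obtain x y where w: "(x, y) \<in> trap" "(x, y) \<in> SW" "w = F a b (x, y)" by auto
    have "w = (a, b) + (- x - y) *\<^sub>R (1, -1)" using w by (auto simp: F_def quadrant_defs)
    then show "w \<in> K_NE \<union> K_SW" using F_trap w(1,3) unfolding K_SW_def line_def by blast
  qed
qed (intro compact_Int_closed convex_Int compact_trap trap_closed_convex quadrant_closed_convex)+

text \<open>
  The two half-planes bound the image of \<open>NW\<close>, so orbits in \<open>trap\<close> that pass from \<open>NW\<close> to \<open>SE\<close> arrive in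
  \<open>W\<close>.
\<close>

definition W :: "(real \<times> real) set" where
  "W = trap \<inter> SE \<inter> halfplane 1 1 (a + b) \<inter> halfplane 0 (-1) (- a)"

lemma compact_convex_W: "compact W" "convex W"
  unfolding W_def
  by (intro compact_Int_closed convex_Int compact_trap trap_closed_convex quadrant_closed_convex
      halfplane_closed_convex)+

text \<open>
  For \<open>b \<le> 0\<close> the region \<open>W\<close> is contained in \<open>SW\<close>. For \<open>b > 0\<close>, orbits that start in \<open>W\<close> and avoid the
  collapsing quadrants for three steps follow the itinerary \<open>SE, NW, NW\<close> and are then back in \<open>W\<close>:
  those that stay in \<open>SE\<close> for a second step reach \<open>SW\<close> at most two steps later. The return map
  along the first itinerary is a similarity with ratio \<open>2 * sqrt 2\<close> that rotates by -45 degrees, so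
  its fourth power is a homothety with ratio -64; its fixed point gives rise to a 3-cycle of the map
  when it lies in the right region.
\<close>

lemma tame_region_W: "tame_region W"
proof (cases "b \<le> 0")
  case True
  have "(x, y) \<in> trap \<inter> SW" if "(x, y) \<in> W" for x y
    using that True neg unfolding W_def by (auto simp: quadrant_defs)
  then show ?thesis by (intro tame_region_subset[OF tame_region_SW]) auto
next
  case False
  \<comment> \<open>\<open>W'\<close> and \<open>U\<close> follow the itinerary \<open>SE, SE, NW\<close>, which ends in \<open>SW\<close>; \<open>V\<close> and \<open>V'\<close> follow the loop.\<close>
  define W' where "W' = se ` W \<inter> SE"
  define U where "U = se ` W' \<inter> NW"
  define V where "V = se ` W \<inter> NW"
  define V' where "V' = nw ` V \<inter> NW"
  have FW: "F a b ` W = se ` W" using F_SE by (intro image_cong) (auto simp: W_def)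
  have FW': "F a b ` W' = se ` W'" using F_SE by (intro image_cong) (auto simp: W'_def)
  have FV: "F a b ` V = nw ` V" using F_NW by (intro image_cong) (auto simp: V_def)
  have WX: "W \<subseteq> trap" by (auto simp: W_def)
  have seW: "se ` W \<subseteq> trap" using FW F_trap WX by blast
  then have W'X: "W' \<subseteq> trap" and VX: "V \<subseteq> trap" unfolding W'_def V_def by auto
  have seW': "se ` W' \<subseteq> trap" using FW' F_trap W'X by blast
  then have UX: "U \<subseteq> trap" unfolding U_def by auto
  have nwV: "nw ` V \<subseteq> trap" using FV F_trap VX by blast
  then have V'X: "V' \<subseteq> trap" unfolding V'_def by auto
  have FV': "F a b ` V' = nw ` V'" using F_NW by (intro image_cong) (auto simp: V'_def)
  have nwV': "nw ` V' \<subseteq> trap" using FV' F_trap V'X by blast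
  note cc_intros = conjI compact_Int_closed convex_Int affine_map_image(1,2)[OF affine_se]
    affine_map_image(1,2)[OF affine_nw] quadrant_closed_convex
  have cc: "compact W' \<and> convex W'" "compact V \<and> convex V"
    unfolding W'_def V_def by (intro cc_intros compact_convex_W)+
  have cc': "compact U \<and> convex U" "compact V' \<and> convex V'"
    unfolding U_def V'_def
    by (intro cc_intros conjunct1[OF cc(1)] conjunct2[OF cc(1)] conjunct1[OF cc(2)] conjunct2[OF cc(2)])+
  have memW: "0 \<le> x \<and> y \<le> 0 \<and> x + y \<le> a + b \<and> a \<le> y" if "(x, y) \<in> W" for x y
    using that unfolding W_def by (auto simp: quadrant_defs)
  have U_SW: "F a b ` U \<subseteq> trap \<inter> SW"
  proof
    fix w assume w: "w \<in> F a b ` U"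
    then obtain x y where xy: "(x, y) \<in> W" "se (x, y) \<in> SE" "se (se (x, y)) \<in> NW"
      "w = F a b (se (se (x, y)))" unfolding U_def W'_def by auto
    then have "w \<in> SW" using memW[OF xy(1)] False neg
      unfolding xy(4) F_NW[OF xy(3)] by (auto simp: se_def nw_def quadrant_defs)
    then show "w \<in> trap \<inter> SW" using w UX F_trap by blast
  qed
  have U: "tame_region U"
    by (rule tame_region_step[OF _ _ affine_nw F_NW tame_region_SW U_SW])
      (use cc' in \<open>auto simp: U_def\<close>)
  have "se ` W' \<subseteq> trap \<inter> SW \<union> U"
  proof
    fix w assume w: "w \<in> se ` W'"
    then obtain x y where xy: "(x, y) \<in> W" "se (x, y) \<in> SE"
      "w = se (se (x, y))" unfolding W'_def by auto
    then have "w \<in> SW \<union> NW" using memW[OF xy(1)] False neg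
      by (auto simp: se_def nw_def quadrant_defs)
    then show "w \<in> trap \<inter> SW \<union> U" using w seW' unfolding U_def by blast
  qed
  then have W': "tame_region W'"
    by (intro tame_region_step[OF _ _ affine_se F_SE tame_region_Un[OF tame_region_SW U]])
      (use cc FW' in \<open>auto simp: W'_def\<close>)
  define Z where "Z = trap \<inter> NE \<union> trap \<inter> SW \<union> W'"
  have Z: "tame_region Z" unfolding Z_def by (intro tame_region_Un tame_region_NE tame_region_SW W')
  have WZ: "se ` W \<subseteq> V \<union> Z"
    using seW trap_quadrants unfolding V_def W'_def Z_def by blast
  have VZ: "nw ` V \<subseteq> V' \<union> Z"
  proof
    fix w assume w: "w \<in> nw ` V"
    then obtain x y where xy: "(x, y) \<in> W" "se (x, y) \<in> NW" "w = nw (se (x, y))" unfolding V_def by auto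
    then have "w \<in> SW \<union> NW" using memW[OF xy(1)] False neg
      by (auto simp: se_def nw_def quadrant_defs)
    then show "w \<in> V' \<union> Z" using w nwV unfolding V'_def Z_def by blast
  qed
  have V'Z: "nw ` V' \<subseteq> W \<union> Z"
  proof
    fix w assume w: "w \<in> nw ` V'"
    then obtain x y where xy: "(x, y) \<in> W" "se (x, y) \<in> NW" "nw (se (x, y)) \<in> NW"
      "w = nw (nw (se (x, y)))" unfolding V_def V'_def by auto
    have "w \<in> trap" using w nwV' by blast
    moreover have "w \<in> SW \<union> (SE \<inter> halfplane 1 1 (a + b) \<inter> halfplane 0 (-1) (- a))"
      using memW[OF xy(1)] xy False neg
      by (auto simp: se_def nw_def quadrant_defs)
    ultimately show "w \<in> W \<union> Z" unfolding W_def Z_def by blast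
  qed
  define Y where "Y = (\<lambda>n::nat. if n mod 3 = 0 then W else if n mod 3 = 1 then V else V')"
  define A where "A = (\<lambda>n::nat. if n mod 3 = 0 then se else nw)"
  \<comment> \<open>The centre is the fixed point of the affine return map \<open>nw \<circ> nw \<circ> se\<close>.\<close>
  have "tame_region (Y 0)"
  proof (rule tame_region_loop[where A = A and Z = Z and m = 3 and j = 4 and
        c = "((- 2 * a - b) / 5, (a - 2 * b) / 5)" and \<mu> = "-64"])
    show "compact (Y n)" "convex (Y n)" "Y n \<subseteq> trap" for n
      using compact_convex_W cc cc' WX VX V'X by (auto simp: Y_def)
    show "affine_map (A n)" for n using affine_nw affine_se by (auto simp: A_def)
    show FA: "F a b z = A n z" if "z \<in> Y n" for n z
      using that F_NW F_SE by (auto simp: Y_def A_def W_def V_def V'_def split: if_splits)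
    show "F a b z \<in> Y (Suc n) \<union> Z" if "z \<in> Y n" for n z
    proof -
      have "n mod 3 < 3" by simp
      then consider "n mod 3 = 0" | "n mod 3 = 1" | "n mod 3 = 2" by linarith
      then show ?thesis
        unfolding FA[OF that] using that WZ VZ V'Z by cases (auto simp: Y_def A_def mod_Suc)
    qed
    show "tame_region Z" by (rule Z)
    show "A (n + 3) = A n" "Y (n + 3) = Y n" for n by (simp_all add: A_def Y_def)
    have ret: "compose_upto A 3 = (\<lambda>(x, y). (2 * x + 2 * y + b, 2 * y - 2 * x - a))"
    proof -
      have "compose_upto A (Suc (Suc (Suc 0))) = nw \<circ> nw \<circ> se"
        by (simp add: A_def comp_assoc)
      then show ?thesis by (simp add: numeral_3_eq_3 se_def nw_def fun_eq_iff)
    qed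
    show "(compose_upto A 3 ^^ 4) z = ((- 2 * a - b) / 5, (a - 2 * b) / 5) +
        (-64) *\<^sub>R (z - ((- 2 * a - b) / 5, (a - 2 * b) / 5))" for z
      unfolding ret by (cases z) (simp add: eval_nat_numeral field_simps)
  qed simp_all
  then show ?thesis by (simp add: Y_def)
qed

text \<open>
  From \<open>NW\<close> one can stay in \<open>NW\<close>, collapse, or enter \<open>W\<close>; the centre is the fixed point of \<open>nw\<close>.
\<close>

lemma tame_region_NW: "tame_region (trap \<inter> NW)"
proof (rule tame_region_loop[where Y = "\<lambda>_. trap \<inter> NW" and A = "\<lambda>_. nw" and
      Z = "trap \<inter> NE \<union> trap \<inter> SW \<union> W"
      and m = 1 and j = 4 and c = "((2 * a - b) / 5, (a + 2 * b) / 5)" and \<mu> = "-4"])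
  show "tame_region (trap \<inter> NE \<union> trap \<inter> SW \<union> W)"
    by (intro tame_region_Un tame_region_NE tame_region_SW tame_region_W)
  show "F a b z \<in> trap \<inter> NW \<union> (trap \<inter> NE \<union> trap \<inter> SW \<union> W)" if z: "z \<in> trap \<inter> NW" for z
  proof -
    obtain x y where xy: "z = (x, y)" by fastforce
    have "F a b z \<in> trap" using z F_trap by blast
    moreover have "F a b z \<in> halfplane 1 1 (a + b) \<and> F a b z \<in> halfplane 0 (-1) (- a)"
      using z by (auto simp: xy trap_def quadrant_defs F_def)
    ultimately show ?thesis using trap_quadrants unfolding W_def by blast
  qed
  show "(compose_upto (\<lambda>_. nw) 1 ^^ 4) z = ((2 * a - b) / 5, (a + 2 * b) / 5) +
      (-4) *\<^sub>R (z - ((2 * a - b) / 5, (a + 2 * b) / 5))" for z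
    by (cases z) (simp add: eval_nat_numeral nw_def field_simps)
qed (simp_all add: affine_nw F_NW compact_Int_closed convex_Int compact_trap trap_closed_convex
    quadrant_closed_convex)

lemma tame_region_SE: "tame_region (trap \<inter> SE)"
proof (rule tame_region_loop[where Y = "\<lambda>_. trap \<inter> SE" and A = "\<lambda>_. se" and
      Z = "trap \<inter> NE \<union> trap \<inter> SW \<union> trap \<inter> NW"
      and m = 1 and j = 4 and c = "(- b, a)" and \<mu> = "-4"])
  show "tame_region (trap \<inter> NE \<union> trap \<inter> SW \<union> trap \<inter> NW)"
    by (intro tame_region_Un tame_region_NE tame_region_SW tame_region_NW)
  show "F a b z \<in> trap \<inter> SE \<union> (trap \<inter> NE \<union> trap \<inter> SW \<union> trap \<inter> NW)" if z: "z \<in> trap \<inter> SE" for z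
    using z F_trap trap_quadrants by blast
  show "(compose_upto (\<lambda>_. se) 1 ^^ 4) z = (- b, a) + (-4) *\<^sub>R (z - (- b, a))" for z
    by (cases z) (simp add: eval_nat_numeral se_def)
qed (simp_all add: affine_se F_SE compact_Int_closed convex_Int compact_trap trap_closed_convex
    quadrant_closed_convex)

lemma tame_region_trap: "tame_region trap"
  by (subst trap_quadrants) (intro tame_region_Un tame_region_NE tame_region_NW tame_region_SW tame_region_SE)

lemma invariant_segments:
  obtains \<S> where "finite \<S>" "\<And>S. S \<in> \<S> \<Longrightarrow> seg S" "F a b ` \<Union>\<S> \<subseteq> \<Union>\<S>"
    "\<And>z. \<exists>n. (F a b ^^ n) z \<in> \<Union>\<S>"
proof -
  have seg: "seg S" if "S \<in> {K_NE, K_SW}" for S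
    using that seg_line_Int[OF compact_trap trap_closed_convex(2)]
    unfolding K_NE_def K_SW_def by blast
  have sub: "K_NE \<union> K_SW \<subseteq> trap" unfolding K_NE_def K_SW_def by blast
  obtain \<S> where \<S>: "finite \<S>" "\<And>S. S \<in> \<S> \<Longrightarrow> seg S" "F a b ` \<Union>\<S> \<subseteq> \<Union>\<S>"
    "\<And>z. z \<in> trap \<Longrightarrow> \<exists>n. (F a b ^^ n) z \<in> \<Union>\<S>"
    by (rule tame_region_imp_invariant_segments[OF tame_region_trap, of "{K_NE, K_SW}",
          OF _ seg _ sub]) simp_all
  have "\<exists>n. (F a b ^^ n) z \<in> \<Union>\<S>" for z
  proof -
    obtain n where "(F a b ^^ n) ((F a b ^^ 5) z) \<in> \<Union>\<S>" using \<S>(4)[OF F_power5_trap] by blast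
    then have "(F a b ^^ (n + 5)) z \<in> \<Union>\<S>" by (simp add: funpow_add)
    then show ?thesis by blast
  qed
  with \<S> show thesis using that by blast
qed

end

section \<open>The invariant graph\<close>

theorem theoremB:
  fixes a b :: real
  assumes "a < 0"
  shows "\<exists>\<Gamma> :: (real \<times> real) set.
           (\<exists>V. graph (top_of_set \<Gamma>) V) \<and>
           F a b ` \<Gamma> \<subseteq> \<Gamma> \<and>
           (\<forall>p :: real \<times> real. \<exists>n :: nat. (F a b ^^ n) p \<in> \<Gamma>)"
proof -
  interpret F_map a b by unfold_locales (fact assms)
  show ?thesis
  proof (rule invariant_segments)
    fix \<S> :: "(real \<times> real) set set"
    assume "finite \<S>" "\<And>S. S \<in> \<S> \<Longrightarrow> seg S" "F a b ` \<Union>\<S> \<subseteq> \<Union>\<S>"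
      "\<And>z. \<exists>n. (F a b ^^ n) z \<in> \<Union>\<S>"
    then show ?thesis
      by (intro exI[of _ "\<Union>\<S>"] conjI allI graph_Union_segments)
  qed
qed

end
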